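(* Let $(C,\sqsubseteq)$ be a complete lattice, $b^*,b_*\colon C\to C$ monotone maps with $b^*$ left adjoint to $b_*$, $a\colon C\to C$ an up-closure operator and $i,f\in C$. If $a\sqsubseteq\omega_{b_*,f}$ (pointwise), then $a$ is $(i\sqcup b^*,f)$-complete.
   Context: $b^*$ left adjoint to $b_*$: $b^*(x)\sqsubseteq y$ iff $x\sqsubseteq b_*(y)$. An up-closure operator is a monotone $a$ with $x\sqsubseteq a(x)$, $a(a(x))\sqsubseteq a(x)$. A monotone $c\colon C\to C$ is $(b_*,f)$-compatible iff $c(f)\sqsubseteq f$ and $c\circ b_*\sqsubseteq b_*\circ c$; the $f$-companion is $\omega_{b_*,f}=\bigsqcup\{c\mid c \text{ monotone and } (b_*,f)\text{-compatible}\}$ (pointwise join). $i\sqcup b^*$ is the map $x\mapsto i\sqcup b^*(x)$. An up-closure $a$ is $(g,f)$-complete iff $a(f)\sqsubseteq f$ and ($\mu(a\circ g)\sqsubseteq f$ iff $\mu g\sqsubseteq f$), $\mu$ denoting least fixed point. *)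

theory Defs
  imports Main
begin

text \<open>
  The complete lattice is the type class \<^class>\<open>complete_lattice\<close>. On functions
  \<open>\<le>\<close> and \<^const>\<open>Sup\<close> are the pointwise order and the pointwise join.
\<close>

definition left_adjoint :: "('a::order \<Rightarrow> 'a) \<Rightarrow> ('a \<Rightarrow> 'a) \<Rightarrow> bool" where
  "left_adjoint l r \<longleftrightarrow> (\<forall>x y. l x \<le> y \<longleftrightarrow> x \<le> r y)"

definition up_closure :: "('a::order \<Rightarrow> 'a) \<Rightarrow> bool" where
  "up_closure a \<longleftrightarrow> mono a \<and> (\<forall>x. x \<le> a x) \<and> (\<forall>x. a (a x) \<le> a x)"

definition compatible :: "('a::order \<Rightarrow> 'a) \<Rightarrow> 'a \<Rightarrow> ('a \<Rightarrow> 'a) \<Rightarrow> bool" where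
  "compatible b f c \<longleftrightarrow> c f \<le> f \<and> c \<circ> b \<le> b \<circ> c"

definition companion :: "('a::complete_lattice \<Rightarrow> 'a) \<Rightarrow> 'a \<Rightarrow> 'a \<Rightarrow> 'a" where
  "companion b f = Sup {c. mono c \<and> compatible b f c}"

text \<open>
  \<^const>\<open>lfp\<close> is the least pre-fixed point, which is the least fixed point for
  monotone functions; \<open>complete_for\<close> is only meant for monotone \<open>g\<close> and up-closures \<open>a\<close>.
\<close>

definition complete_for ::
  "('a::complete_lattice \<Rightarrow> 'a) \<Rightarrow> 'a \<Rightarrow> ('a \<Rightarrow> 'a) \<Rightarrow> bool" where
  "complete_for g f a \<longleftrightarrow> a f \<le> f \<and> (lfp (a \<circ> g) \<le> f \<longleftrightarrow> lfp g \<le> f)"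

end

(* The companion w is itself the largest compatible map, so it is extensive and idempotent.
   Transposing the compatibility of w along the adjunction gives b_up o w <= w o b_up. Hence
   w (lfp g), where g x = sup i (b_up x), is again closed under g; since it is also closed
   under a <= w, it lies above lfp (a o g), while lfp g <= f gives w (lfp g) <= w f <= f. *)
theory Submission
  imports Defs
begin

lemma companion_upper:
  assumes "mono c" "compatible b f c"
  shows "c x \<le> companion b f x"
proof -
  have "c \<le> companion b f"
    unfolding companion_def using assms by (intro Sup_upper) simp
  then show ?thesis by (rule le_funD)
qed

lemma companion_leI:
  assumes "\<And>c. mono c \<Longrightarrow> compatible b f c \<Longrightarrow> c x \<le> y"
  shows "companion b f x \<le> y"
  unfolding companion_def Sup_apply using assms by (auto intro!: SUP_least)

lemma mono_companion: "mono (companion b f)"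
proof (intro monoI companion_leI)
  fix x y :: 'a and c
  assume "x \<le> y" and c: "mono c" "compatible b f c"
  then have "c x \<le> c y" by (simp add: monoD)
  also have "\<dots> \<le> companion b f y" using c by (rule companion_upper)
  finally show "c x \<le> companion b f y" .
qed

lemma companion_le: "companion b f f \<le> f"
  by (rule companion_leI) (simp add: compatible_def)

text \<open>Each compatible \<open>c\<close> satisfies the inequality, and monotonicity of
  \<open>b\<close> lets \<open>c x\<close> be enlarged to the companion under \<open>b\<close>. Thus
  compatibility survives the join.\<close>

lemma companion_step_le:
  assumes "mono b"
  shows "companion b f (b x) \<le> b (companion b f x)"
proof (rule companion_leI)
  fix c assume c: "mono c" "compatible b f c"
  then have "c (b x) \<le> b (c x)" by (simp add: compatible_def le_fun_def)
  also have "\<dots> \<le> b (companion b f x)" using assms companion_upper[OF c] by (rule monoD)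
  finally show "c (b x) \<le> b (companion b f x)" .
qed

lemma compatible_companion:
  assumes "mono b"
  shows "compatible b f (companion b f)"
  using assms by (simp add: compatible_def le_fun_def companion_le companion_step_le)

text \<open>Both conditions for \<open>d\<close> are pushed through the monotone outer map
  \<open>c\<close>, then followed by those for \<open>c\<close>. Used with both maps equal to the
  companion.\<close>

lemma compatible_comp:
  assumes "mono c" "compatible b f c" "compatible b f d"
  shows "compatible b f (c \<circ> d)"
  unfolding compatible_def le_fun_def comp_def
proof (intro conjI allI)
  show "c (d f) \<le> f"
    using assms by (meson compatible_def monoD order_trans)
  fix x
  have "c (d (b x)) \<le> c (b (d x))"
    using assms by (auto simp: compatible_def le_fun_def intro: monoD)
  also have "\<dots> \<le> b (c (d x))"
    using assms by (simp add: compatible_def le_fun_def)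
  finally show "c (d (b x)) \<le> b (c (d x))" .
qed

text \<open>The identity is compatible.\<close>

lemma companion_extensive: "x \<le> companion b f x"
  using companion_upper[of "\<lambda>x. x" b f x] by (simp add: compatible_def mono_def le_fun_def)

text \<open>The companion composed with itself is monotone and compatible, hence one of the maps in
  the join.\<close>

lemma companion_idem_le:
  assumes "mono b"
  shows "companion b f (companion b f x) \<le> companion b f x"
proof -
  have "mono (companion b f \<circ> companion b f)"
    by (rule monotone_on_o[OF mono_companion mono_companion]) simp
  moreover have "compatible b f (companion b f \<circ> companion b f)"
    using assms by (intro compatible_comp mono_companion compatible_companion)
  ultimately show ?thesis using companion_upper by fastforce
qed

text \<open>The mate of \<open>comm\<close> under the adjunction: insert the unit
  \<open>x \<le> r (l x)\<close>, apply \<open>comm\<close> at \<open>l x\<close>, and transpose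
  back.\<close>

lemma left_adjoint_commute:
  fixes c :: "'a::order \<Rightarrow> 'a"
  assumes "left_adjoint l r" "mono c" and comm: "\<And>x. c (r x) \<le> r (c x)"
  shows "l (c x) \<le> c (l x)"
proof -
  have "x \<le> r (l x)" using assms(1) by (auto simp: left_adjoint_def)
  with \<open>mono c\<close> have "c x \<le> c (r (l x))" by (rule monoD)
  also have "\<dots> \<le> r (c (l x))" by (rule comm)
  finally show ?thesis using assms(1) by (simp add: left_adjoint_def)
qed

theorem theorem9p10:
  fixes b_up b_low a :: "'a::complete_lattice \<Rightarrow> 'a"
    and i f :: 'a
  assumes "mono b_up"
    and "mono b_low"
    and "left_adjoint b_up b_low"
    and "up_closure a"
    and "a \<le> companion b_low f"
  shows "complete_for (\<lambda>x. sup i (b_up x)) f a"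
proof -
  define g where "g = (\<lambda>x. sup i (b_up x))"
  let ?w = "companion b_low f"
  note mono_w = monoD[OF mono_companion[of b_low f]]
  have a_le: "a x \<le> ?w x" for x using assms(5) by (rule le_funD)
  have "mono g"
    using assms(1) by (auto simp: g_def mono_def intro: sup.coboundedI2)
  have "a f \<le> f"
    using a_le companion_le by (rule order_trans)
  moreover have "lfp (a \<circ> g) \<le> f" if "lfp g \<le> f"
  proof -
    have "g (lfp g) \<le> lfp g" using lfp_unfold[OF \<open>mono g\<close>] by simp
    then have i: "i \<le> lfp g" and b: "b_up (lfp g) \<le> lfp g" by (simp_all add: g_def)
    have "b_up (?w (lfp g)) \<le> ?w (b_up (lfp g))"
      using assms(3) mono_companion companion_step_le[OF assms(2)] by (rule left_adjoint_commute)
    also have "\<dots> \<le> ?w (lfp g)" using b by (rule mono_w)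
    \<comment> \<open>The summand \<open>i\<close> lies below \<open>lfp g\<close>, hence below
      \<open>?w (lfp g)\<close> by extensiveness.\<close>
    finally have "g (?w (lfp g)) \<le> ?w (lfp g)"
      using order_trans[OF i companion_extensive] by (simp add: g_def)
    then have "a (g (?w (lfp g))) \<le> ?w (?w (lfp g))"
      using a_le mono_w order_trans by blast
    also have "\<dots> \<le> ?w (lfp g)" using assms(2) by (rule companion_idem_le)
    \<comment> \<open>\<open>?w (lfp g)\<close> is a pre-fixed point of
      \<open>a \<circ> g\<close>.\<close>
    finally have "lfp (a \<circ> g) \<le> ?w (lfp g)" by (simp add: lfp_lowerbound)
    also have "\<dots> \<le> ?w f" using that by (rule mono_w)
    also have "\<dots> \<le> f" by (rule companion_le)
    finally show ?thesis .
  qed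
  \<comment> \<open>For the other implication: \<open>a\<close> is extensive, so
    \<open>g \<le> a \<circ> g\<close> pointwise.\<close>
  moreover have "lfp g \<le> lfp (a \<circ> g)"
    using assms(4) by (intro lfp_mono) (simp add: up_closure_def)
  ultimately show ?thesis
    unfolding complete_for_def g_def by (meson order_trans)
qed

end
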